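(* Let $G$ be a finite, simple, connected, undirected graph and let $\ell, m \ge 1$ be integers. If $G$ does not contain a complete bipartite subgraph $K_{\ell,m}$, then the index of its box complex $\mathsf{B}(G)$ satisfies $$\operatorname{ind}(\mathsf{B}(G)) \le \ell + m - 3 .$$
   Context: $V(G)$ is the node set of $G$. $K_{\ell,m}$ is the complete bipartite graph with parts of sizes $\ell$ and $m$; "contains" means as a (not necessarily induced) subgraph. Common neighborhood: for $A\subseteq V(G)$, $\mathrm{CN}(A)$ is the set of all nodes $v\in V(G)$ adjacent to every $a\in A$; in particular $\mathrm{CN}(\emptyset)=V(G)$. Neighborhood complex: $\mathsf{N}(G)$ is the abstract simplicial complex whose simplices are the sets $A\subseteq V(G)$ with $\mathrm{CN}(A)\neq\emptyset$. For sets $A,B$ put $A\uplus B := \{(a,0): a\in A\}\cup\{(b,1): b\in B\}$. Box complex: $\mathsf{B}(G) := \{A\uplus B : A,B\in \mathsf{N}(G),\ A\subseteq \mathrm{CN}(B),\ B\subseteq\mathrm{CN}(A)\}$ (either of $A,B$ may be empty). It is an abstract simplicial complex, with the simplicial free $\mathbb{Z}_2$-action $\nu$ which interchanges the two copies, $(v,0)\leftrightarrow(v,1)$, i.e. $A\uplus B\mapsto B\uplus A$. A $\mathbb{Z}_2$-space is a topological space $X$ with a self-inverse homeomorphism $\nu:X\to X$ without fixed points. The sphere $S^d$ is a $\mathbb{Z}_2$-space via the antipodal map $x\mapsto -x$. A $\mathbb{Z}_2$-map between $\mathbb{Z}_2$-spaces is a continuous map commuting with the actions. The index $\operatorname{ind}(X)$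 of a $\mathbb{Z}_2$-space $X$ is the smallest $d$ such that there is a $\mathbb{Z}_2$-map $X\to S^d$, with the usual convention $S^{-1}=\emptyset$, so that the empty space has index $-1$. The index of a simplicial complex with a free simplicial $\mathbb{Z}_2$-action is the index of its geometric realization. *)

theory Defs
  imports
    "Graph_Theory.Graph_Theory"
    "HOL-Analysis.Analysis"
begin

definition Z2_space :: "'x topology \<Rightarrow> ('x \<Rightarrow> 'x) \<Rightarrow> bool" where
  "Z2_space X \<nu> \<longleftrightarrow>
     homeomorphic_map X X \<nu> \<and> (\<forall>x\<in>topspace X. \<nu> (\<nu> x) = x \<and> \<nu> x \<noteq> x)"

definition Z2_map ::
  "'x topology \<Rightarrow> ('x \<Rightarrow> 'x) \<Rightarrow> 'y topology \<Rightarrow> ('y \<Rightarrow> 'y) \<Rightarrow> ('x \<Rightarrow> 'y) \<Rightarrow> bool" where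
  "Z2_map X \<nu> Y \<mu> f \<longleftrightarrow>
     continuous_map X Y f \<and> (\<forall>x\<in>topspace X. f (\<nu> x) = \<mu> (f x))"

definition Z2_sphere :: "int \<Rightarrow> (nat \<Rightarrow> real) topology" where
  "Z2_sphere d = (if d < 0 then discrete_topology {} else nsphere (nat d))"

definition antipode :: "(nat \<Rightarrow> real) \<Rightarrow> nat \<Rightarrow> real" where
  "antipode x = (\<lambda>i. - x i)"

text \<open>
  The infimum ranges over integers that are at least \<open>-1\<close>, so it is a minimum whenever a
  \<open>\<int>\<^sub>2\<close>-map to some sphere exists; otherwise the index is \<open>\<infinity>\<close>.
\<close>
definition Z2_index :: "'x topology \<Rightarrow> ('x \<Rightarrow> 'x) \<Rightarrow> ereal" where
  "Z2_index X \<nu> =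
     Inf {ereal (of_int d) | d. -1 \<le> d \<and> (\<exists>f. Z2_map X \<nu> (Z2_sphere d) antipode f)}"

text \<open>
  Points are given by barycentric coordinates: nonnegative functions on the vertices with
  coordinate sum 1 whose support is a simplex. The topology is that of pointwise convergence,
  which is the usual one for finite complexes (and only for those is it used here). The empty
  simplex contributes no point.
\<close>
definition geometric_realization :: "'v set set \<Rightarrow> ('v \<Rightarrow> real) topology" where
  "geometric_realization K = subtopology (powertop_real UNIV)
     {x. (\<forall>v. 0 \<le> x v) \<and> {v. x v \<noteq> 0} \<in> K \<and> (\<Sum>v | x v \<noteq> 0. x v) = 1}"

text \<open>
  The affine extension of an involution \<open>s\<close> of the vertices: the coordinate at \<open>s v\<close> of the
  image of \<open>x\<close> is \<open>x v\<close>, and \<open>s\<close> is its own inverse.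
\<close>
definition realization_involution :: "('v \<Rightarrow> 'v) \<Rightarrow> ('v \<Rightarrow> real) \<Rightarrow> 'v \<Rightarrow> real" where
  "realization_involution s x = x \<circ> s"

definition complex_index :: "'v set set \<Rightarrow> ('v \<Rightarrow> 'v) \<Rightarrow> ereal" where
  "complex_index K s = Z2_index (geometric_realization K) (realization_involution s)"

definition common_nbhd :: "'a pair_pre_digraph \<Rightarrow> 'a set \<Rightarrow> 'a set" where
  "common_nbhd G A = {v \<in> pverts G. \<forall>a\<in>A. (a, v) \<in> parcs G}"

definition nbhd_complex :: "'a pair_pre_digraph \<Rightarrow> 'a set set" where
  "nbhd_complex G = {A. A \<subseteq> pverts G \<and> common_nbhd G A \<noteq> {}}"

text \<open>The two copies of the vertex set are the two summands of the sum type.\<close>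
definition box_complex :: "'a pair_pre_digraph \<Rightarrow> ('a + 'a) set set" where
  "box_complex G = {A <+> B | A B. A \<in> nbhd_complex G \<and> B \<in> nbhd_complex G \<and>
     A \<subseteq> common_nbhd G B \<and> B \<subseteq> common_nbhd G A}"

definition swap_copies :: "'a + 'a \<Rightarrow> 'a + 'a" where
  "swap_copies = case_sum Inr Inl"

lemma swap_copies_simps [simp]:
  "swap_copies (Inl a) = Inr a" "swap_copies (Inr a) = Inl a"
  "swap_copies (swap_copies v) = v"
  by (auto simp: swap_copies_def split: sum.splits)

lemma swap_copies_image_Plus: "swap_copies ` (A <+> B) = B <+> A"
  by (simp add: Plus_def image_Un image_image Un_commute)

lemma box_complex_finite:
  assumes "finite (pverts G)" "\<sigma> \<in> box_complex G"
  shows "finite \<sigma>"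
proof -
  obtain A B where "\<sigma> = A <+> B" "A \<subseteq> pverts G" "B \<subseteq> pverts G"
    using assms(2) by (auto simp: box_complex_def nbhd_complex_def)
  then show ?thesis using assms(1) by (simp add: finite_subset)
qed

lemma nbhd_complex_subset:
  "A \<in> nbhd_complex G \<Longrightarrow> A' \<subseteq> A \<Longrightarrow> A' \<in> nbhd_complex G"
  unfolding nbhd_complex_def common_nbhd_def by blast

lemma box_complex_subset:
  assumes "\<sigma> \<in> box_complex G" "\<tau> \<subseteq> \<sigma>"
  shows "\<tau> \<in> box_complex G"
proof -
  obtain A B where AB: "\<sigma> = A <+> B" "A \<in> nbhd_complex G" "B \<in> nbhd_complex G"
      "A \<subseteq> common_nbhd G B" "B \<subseteq> common_nbhd G A"
    using assms(1) by (auto simp: box_complex_def)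
  define A' B' where "A' = Inl -` \<tau>" and "B' = Inr -` \<tau>"
  have sub: "A' \<subseteq> A" "B' \<subseteq> B"
    using assms(2) AB(1) by (auto simp: A'_def B'_def)
  have "\<tau> = A' <+> B'"
  proof (rule set_eqI)
    fix v show "v \<in> \<tau> \<longleftrightarrow> v \<in> A' <+> B'"
      by (cases v) (auto simp: A'_def B'_def)
  qed
  moreover have "A' \<subseteq> common_nbhd G B'" "B' \<subseteq> common_nbhd G A'"
    using AB(4,5) sub unfolding common_nbhd_def by blast+
  ultimately show ?thesis
    using nbhd_complex_subset[OF AB(2) sub(1)] nbhd_complex_subset[OF AB(3) sub(2)]
    unfolding box_complex_def by blast
qed

lemma box_complex_swap: "\<sigma> \<in> box_complex G \<Longrightarrow> swap_copies ` \<sigma> \<in> box_complex G"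
  unfolding box_complex_def by (auto simp: swap_copies_image_Plus) blast

lemma Z2_space_sphere: "Z2_space (Z2_sphere d) antipode"
proof (cases "d < 0")
  case True
  then show ?thesis
    by (simp add: Z2_space_def Z2_sphere_def homeomorphic_map_def quotient_map_def)
next
  case False
  define n where "n = nat d"
  have c: "continuous_map (nsphere n) (nsphere n) antipode"
    unfolding nsphere continuous_map_in_subtopology continuous_map_componentwise_UNIV antipode_def
    by (auto intro!: continuous_map_from_subtopology continuous_map_minus
          continuous_map_product_projection)
  have ne: "antipode x \<noteq> x" if "x \<in> topspace (nsphere n)" for x
  proof
    assume "antipode x = x"
    then have "x i = 0" for i
      by (metis antipode_def neg_equal_zero)
    then show False using that by (simp add: nsphere)
  qed
  have "homeomorphic_maps (nsphere n) (nsphere n) antipode antipode"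
    using c by (simp add: homeomorphic_maps_def antipode_def)
  then have "homeomorphic_map (nsphere n) (nsphere n) antipode"
    using homeomorphic_map_maps by blast
  then show ?thesis
    using ne False by (auto simp: Z2_space_def Z2_sphere_def n_def antipode_def)
qed

lemma Z2_space_box_complex:
  assumes "pair_graph G"
  shows "Z2_space (geometric_realization (box_complex G)) (realization_involution swap_copies)"
proof -
  interpret pair_graph G by fact
  let ?X = "geometric_realization (box_complex G)"
  let ?\<nu> = "realization_involution swap_copies :: ('a + 'a \<Rightarrow> real) \<Rightarrow> _"
  have inj: "inj_on swap_copies S" for S :: "('a + 'a) set"
    by (rule inj_on_inverseI[of _ swap_copies]) simp
  have supp: "{v. (x \<circ> swap_copies) v \<noteq> 0} = swap_copies ` {v. x v \<noteq> 0}"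
    for x :: "'a + 'a \<Rightarrow> real"
    by (auto simp: image_iff) (metis swap_copies_simps(3))
  have sum: "(\<Sum>v | (x \<circ> swap_copies) v \<noteq> 0. (x \<circ> swap_copies) v) = (\<Sum>v | x v \<noteq> 0. x v)"
    for x :: "'a + 'a \<Rightarrow> real"
    unfolding supp by (subst sum.reindex[OF inj]) simp
  have c: "continuous_map ?X ?X ?\<nu>"
    unfolding geometric_realization_def continuous_map_in_subtopology
      continuous_map_componentwise_UNIV realization_involution_def
  proof (intro conjI allI)
    fix k :: "'a + 'a"
    show "continuous_map (subtopology (powertop_real UNIV)
       {x. (\<forall>v. 0 \<le> x v) \<and> {v. x v \<noteq> 0} \<in> box_complex G \<and> (\<Sum>v | x v \<noteq> 0. x v) = 1})
       euclideanreal (\<lambda>x. (x \<circ> swap_copies) k)"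
      by (auto intro!: continuous_map_from_subtopology continuous_map_product_projection)
  next
    show "(\<lambda>x. x \<circ> swap_copies) \<in> topspace (subtopology (powertop_real UNIV)
       {x. (\<forall>v. 0 \<le> x v) \<and> {v. x v \<noteq> 0} \<in> box_complex G \<and> (\<Sum>v | x v \<noteq> 0. x v) = 1})
       \<rightarrow> {x. (\<forall>v. 0 \<le> x v) \<and> {v. x v \<noteq> 0} \<in> box_complex G \<and> (\<Sum>v | x v \<noteq> 0. x v) = 1}"
      unfolding Pi_iff mem_Collect_eq sum unfolding supp by (auto intro: box_complex_swap)
  qed
  have inv: "?\<nu> (?\<nu> x) = x" for x
    by (auto simp: realization_involution_def)
  have ne: "?\<nu> x \<noteq> x" if "x \<in> topspace ?X" for x
  proof
    assume eq: "?\<nu> x = x"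
    have S: "{v. x v \<noteq> 0} \<in> box_complex G" "(\<Sum>v | x v \<noteq> 0. x v) = 1"
      using that by (auto simp: geometric_realization_def)
    obtain A B where AB: "{v. x v \<noteq> 0} = A <+> B" "A \<subseteq> common_nbhd G B"
      using S(1) by (auto simp: box_complex_def)
    have sym: "x (Inl a) = x (Inr a)" for a
      using fun_cong[OF eq, of "Inr a"] by (simp add: realization_involution_def)
    have mem: "a \<in> A \<longleftrightarrow> a \<in> B" for a
      using AB(1) sym[of a] by (metis (mono_tags) InlI InrI Inl_Inr_False PlusE mem_Collect_eq
          sum.inject)
    have "A = {}" if "A = B"
      using AB(2) that pair_no_loops by (fastforce simp: common_nbhd_def)
    with mem have "{v. x v \<noteq> 0} = {}" using AB(1) by auto
    with S(2) show False by simp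
  qed
  have "homeomorphic_maps ?X ?X ?\<nu> ?\<nu>"
    using c inv by (simp add: homeomorphic_maps_def)
  then have "homeomorphic_map ?X ?X ?\<nu>"
    using homeomorphic_map_maps by blast
  then show ?thesis using inv ne by (auto simp: Z2_space_def)
qed

end

theory Submission
  imports Defs
begin

text \<open>
  Closed sets, those with \<open>CN (CN C) = C\<close>, carry the order-reversing involution \<open>CN\<close>. Sending
  \<open>(A, 0)\<close> to \<open>CN (CN A)\<close> and \<open>(B, 1)\<close> to \<open>CN B\<close> maps the (suitably subdivided) box complex
  equivariantly to the order complex of the closed sets \<open>C\<close> with \<open>C\<close> and \<open>CN C\<close> nonempty. If
  there is no \<open>K\<^bsub>l,m\<^esub>\<close>, then each such set has \<open>|C| < l\<close> or \<open>|CN C| < m\<close>, so a chain has at most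
  \<open>(l - 1) + (m - 1)\<close> members. As there are no loops, \<open>C\<close> and \<open>CN C\<close> are never comparable, and a
  free complex whose simplices have at most \<open>n\<close> vertices maps equivariantly to the boundary of
  the \<open>n\<close>-dimensional cross-polytope: the barycentre of a simplex with \<open>i\<close> vertices goes to
  \<open>\<plusminus>e\<^sub>i\<close>, with signs chosen opposite on opposite simplices.

  Barycentric subdivisions are replaced by weights that are continuous functions of the
  coordinates and whose supports are chains; coordinates are never required to sum to 1, since
  only the final map is normalised.
\<close>

section \<open>Level weights in place of barycentric subdivision\<close>

text \<open>
  Positive exactly if \<open>S\<close> is an upper level set of \<open>x\<close> on \<open>V\<close> at some positive level; it plays
  the role of the coordinate of \<open>x\<close> at the barycentre of \<open>S\<close>.
\<close>
definition level_weight :: "'v set \<Rightarrow> 'v set \<Rightarrow> ('v \<Rightarrow> real) \<Rightarrow> real" where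
  "level_weight V S x = (\<Prod>v\<in>S. max 0 (x v) * (\<Prod>u\<in>V - S. max 0 (x v - x u)))"

lemma level_weight_nonneg: "0 \<le> level_weight V S x"
  unfolding level_weight_def by (intro prod_nonneg ballI mult_nonneg_nonneg) auto

lemma level_weight_pos_iff:
  assumes "finite V" "S \<subseteq> V"
  shows "0 < level_weight V S x \<longleftrightarrow> (\<forall>v\<in>S. 0 < x v \<and> (\<forall>u\<in>V - S. x u < x v))"
proof -
  have max0: "max 0 a = 0 \<longleftrightarrow> \<not> 0 < a" for a :: real by auto
  have "finite S" using assms finite_subset by blast
  then have "level_weight V S x \<noteq> 0 \<longleftrightarrow> (\<forall>v\<in>S. 0 < x v \<and> (\<forall>u\<in>V - S. x u < x v))"
    using assms(1) unfolding level_weight_def by (auto simp: max0)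
  then show ?thesis using level_weight_nonneg[of V S x] by linarith
qed

text \<open>Upper level sets of one function are nested. This replaces the fact that simplices of a
  subdivision are chains.\<close>

lemma level_weight_pos_nested:
  assumes "finite V" "S \<subseteq> V" "T \<subseteq> V" "0 < level_weight V S x" "0 < level_weight V T x"
  shows "S \<subseteq> T \<or> T \<subseteq> S"
proof (rule ccontr)
  assume "\<not> ?thesis"
  then obtain v u where "v \<in> S" "v \<notin> T" "u \<in> T" "u \<notin> S" by blast
  then have "x u < x v" "x v < x u"
    using assms by (auto simp: level_weight_pos_iff)
  then show False by simp
qed

text \<open>The positive support is itself an upper level set. It later supplies a weight that is
  known not to vanish.\<close>

lemma level_weight_support_pos:
  assumes "finite V"
  shows "0 < level_weight V {v \<in> V. 0 < x v} x"
  using assms by (subst level_weight_pos_iff) force+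

lemma level_weight_image:
  assumes "S \<subseteq> V" "\<And>v. v \<in> V \<Longrightarrow> s v \<in> V \<and> s (s v) = v" "\<And>v. v \<in> V \<Longrightarrow> y (s v) = x v"
  shows "level_weight V (s ` S) y = level_weight V S x"
proof -
  have inj: "inj_on s V" using assms(2) by (metis inj_onI)
  have diff: "V - s ` S = s ` (V - S)"
  proof -
    have "s ` V = V" using assms(2) by (force simp: image_iff)
    then show ?thesis using inj assms(1) by (metis Diff_subset inj_on_image_set_diff)
  qed
  have "inj_on s S" "inj_on s (V - S)" using inj assms(1) by (auto intro: inj_on_subset)
  then show ?thesis
    unfolding level_weight_def diff using assms(1,3)
    by (auto simp: prod.reindex subset_iff intro!: prod.cong arg_cong2[where f = "(*)"])
qed

lemma continuous_map_level_weight: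
  assumes "finite V" "S \<subseteq> V" "\<And>v. v \<in> V \<Longrightarrow> continuous_map X euclideanreal (\<lambda>p. y p v)"
  shows "continuous_map X euclideanreal (\<lambda>p. level_weight V S (y p))"
proof -
  have "finite S" using assms finite_subset by blast
  then show ?thesis unfolding level_weight_def using assms
    by (intro continuous_map_prod continuous_map_real_mult continuous_map_real_max
        continuous_map_diff) auto
qed

section \<open>Equivariant maps to spheres\<close>

lemma Z2_map_sphere_normalize:
  fixes F :: "'x \<Rightarrow> nat \<Rightarrow> real"
  assumes cont: "\<And>i. continuous_map X euclideanreal (\<lambda>p. F p i)"
    and nz: "\<And>p. p \<in> topspace X \<Longrightarrow> \<exists>i<n. F p i \<noteq> 0"
    and odd: "\<And>p i. p \<in> topspace X \<Longrightarrow> F (\<nu> p) i = - F p i"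
  shows "\<exists>f. Z2_map X \<nu> (Z2_sphere (int n - 1)) antipode f"
proof (cases n)
  \<comment> \<open>Without coordinates nothing can be nonzero, so \<open>X\<close> is empty and
    maps to the empty sphere of dimension -1.\<close>
  case 0
  then have "X = trivial_topology" using nz by (metis ex_in_conv null_topspace_iff_trivial not_less_zero)
  then show ?thesis by (auto simp: Z2_map_def Z2_sphere_def continuous_map_def)
next
  case (Suc k)
  define N where "N p = sqrt (\<Sum>j\<le>k. (F p j)\<^sup>2)" for p
  have N: "N p \<noteq> 0" if "p \<in> topspace X" for p
  proof -
    obtain i where "i \<le> k" "F p i \<noteq> 0" using nz[OF \<open>p \<in> topspace X\<close>] Suc less_Suc_eq_le by auto
    then show ?thesis unfolding N_def by (simp add: sum_nonneg_eq_0_iff) blast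
  qed
  have contN: "continuous_map X euclideanreal N"
    unfolding N_def using cont
    by (intro continuous_map_sqrt continuous_map_sum continuous_map_real_pow) auto
  \<comment> \<open>Points of \<open>nsphere k\<close> vanish beyond coordinate
    \<open>k\<close>.\<close>
  define f where "f p i = (if i \<le> k then F p i / N p else 0)" for p i
  have "(\<Sum>i\<le>k. (f p i)\<^sup>2) = 1" if "p \<in> topspace X" for p
  proof -
    have "(\<Sum>i\<le>k. (f p i)\<^sup>2) = (\<Sum>i\<le>k. (F p i)\<^sup>2) / (N p)\<^sup>2"
      by (simp add: f_def power_divide sum_divide_distrib)
    also have "\<dots> = 1" using N[OF that] by (simp add: N_def sum_nonneg)
    finally show ?thesis .
  qed
  moreover have "continuous_map X euclideanreal (\<lambda>p. f p i)" for i
    by (cases "i \<le> k") (auto simp: f_def N intro!: continuous_map_real_divide cont contN)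
  ultimately have "continuous_map X (nsphere k) f"
    by (auto simp: nsphere continuous_map_in_subtopology continuous_map_componentwise_UNIV f_def)
  moreover have "f (\<nu> p) = antipode (f p)" if "p \<in> topspace X" for p
    using odd[OF that] by (auto simp: f_def antipode_def N_def)
  ultimately show ?thesis using Suc by (auto simp: Z2_map_def Z2_sphere_def)
qed

lemma Z2_map_sphere_of_coordinates:
  fixes y :: "'x \<Rightarrow> 'v \<Rightarrow> real"
  assumes V: "finite V" and s: "\<And>v. v \<in> V \<Longrightarrow> s v \<in> V \<and> s (s v) = v"
    and cont: "\<And>v. v \<in> V \<Longrightarrow> continuous_map X euclideanreal (\<lambda>p. y p v)"
    and nz: "\<And>p. p \<in> topspace X \<Longrightarrow> \<exists>v\<in>V. 0 < y p v"
    and equi: "\<And>p v. p \<in> topspace X \<Longrightarrow> v \<in> V \<Longrightarrow> y (\<nu> p) (s v) = y p v"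
    and dim: "\<And>p. p \<in> topspace X \<Longrightarrow> card {v \<in> V. 0 < y p v} \<le> n"
    and free: "\<And>p v. p \<in> topspace X \<Longrightarrow> v \<in> V \<Longrightarrow> 0 < y p v \<Longrightarrow> \<not> 0 < y p (s v)"
  shows "\<exists>f. Z2_map X \<nu> (Z2_sphere (int n - 1)) antipode f"
proof -
  obtain enc :: "'v set \<Rightarrow> nat" where enc: "inj_on enc (Pow V)"
    using finite_imp_inj_to_nat_seg V by (metis finite_Pow_iff)
  define sg where "sg S = sgn (real (enc S) - real (enc (s ` S)))" for S
  have ss: "s ` s ` S = S" if "S \<subseteq> V" for S
    using s that by (force simp: image_image)
  have sV: "s ` S \<subseteq> V" if "S \<subseteq> V" for S using s that by blast
  have sg_swap: "sg (s ` S) = - sg S" if "S \<subseteq> V" for S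
    unfolding sg_def ss[OF that] by (simp add: sgn_if)
  define I where "I i = {S. S \<subseteq> V \<and> card S = Suc i}" for i
  have finI: "finite (I i)" for i using V by (auto simp: I_def)
  define F where "F p i = (\<Sum>S\<in>I i. sg S * level_weight V S (y p))" for p i
  show ?thesis
  proof (rule Z2_map_sphere_normalize)
    fix i
    show "continuous_map X euclideanreal (\<lambda>p. F p i)"
      unfolding F_def using finI V cont
      by (intro continuous_map_sum continuous_map_real_mult continuous_map_level_weight)
        (auto simp: I_def)
  next
    fix p assume p: "p \<in> topspace X"
    \<comment> \<open>The coordinate belonging to the size of the full support \<open>S\<close> is
      nonzero: sets of positive weight are nested, so no other set of that size contributes and
      nothing can cancel.\<close>
    define S where "S = {v \<in> V. 0 < y p v}"
    have S: "S \<subseteq> V" "S \<noteq> {}" "finite S" using nz[OF p] V by (auto simp: S_def)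
    define i where "i = card S - 1"
    have i: "card S = Suc i" using S by (simp add: i_def card_gt_0_iff Suc_diff_1)
    have wS: "0 < level_weight V S (y p)"
      unfolding S_def using level_weight_support_pos V by blast
    have "T = S" if "T \<in> I i" "level_weight V T (y p) \<noteq> 0" for T
    proof -
      have T: "T \<subseteq> V" "card T = card S" "finite T"
        using that i V by (auto simp: I_def intro: finite_subset)
      have "0 < level_weight V T (y p)"
        using that(2) level_weight_nonneg[of V T "y p"] by linarith
      then have "T \<subseteq> S \<or> S \<subseteq> T" using level_weight_pos_nested V T(1) S(1) wS by blast
      then show ?thesis using T S(3) by (metis card_subset_eq)
    qed
    then have "F p i = (\<Sum>T\<in>{S}. sg T * level_weight V T (y p))"
      unfolding F_def using finI S i by (intro sum.mono_neutral_right) (auto simp: I_def)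
    moreover have "sg S \<noteq> 0"
    proof -
      obtain v where v: "v \<in> S" using S by blast
      have "s v \<notin> S" using v free[OF p] by (auto simp: S_def)
      then have "s ` S \<noteq> S" using v by blast
      then show ?thesis
        using inj_onD[OF enc, of S "s ` S"] S(1) sV[OF S(1)] by (auto simp: sg_def sgn_if)
    qed
    moreover have "i < n" using dim[OF p] i by (simp add: S_def)
    ultimately show "\<exists>i<n. F p i \<noteq> 0" using wS by auto
  next
    fix p i assume p: "p \<in> topspace X"
    have cards: "card (s ` S) = card S" if "S \<subseteq> V" for S
      using s that by (intro card_image inj_onI) (metis subsetD)
    have "F (\<nu> p) i = (\<Sum>S\<in>I i. sg (s ` S) * level_weight V (s ` S) (y (\<nu> p)))"
      unfolding F_def
      by (rule sum.reindex_bij_witness[of _ "(`) s" "(`) s"])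
        (auto simp: I_def ss cards dest: subsetD[OF sV])
    also have "\<dots> = (\<Sum>S\<in>I i. - (sg S * level_weight V S (y p)))"
    proof (rule sum.cong[OF refl])
      fix S assume "S \<in> I i"
      then have "S \<subseteq> V" by (simp add: I_def)
      then show "sg (s ` S) * level_weight V (s ` S) (y (\<nu> p)) = - (sg S * level_weight V S (y p))"
        using level_weight_image[of S V s "y (\<nu> p)" "y p"] s equi[OF p] sg_swap by simp
    qed
    finally show "F (\<nu> p) i = - F p i" by (simp add: F_def sum_negf)
  qed
qed

section \<open>Closed sets and complete bipartite subgraphs\<close>

lemma common_nbhd_antimono: "A \<subseteq> B \<Longrightarrow> common_nbhd G B \<subseteq> common_nbhd G A"
  by (auto simp: common_nbhd_def)

lemma common_nbhd_subset: "common_nbhd G A \<subseteq> pverts G"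
  by (auto simp: common_nbhd_def)

context pair_graph
begin

lemma parcs_sym: "(a, b) \<in> parcs G \<Longrightarrow> (b, a) \<in> parcs G"
  using pair_sym_arcs by (auto simp: symmetric_def dest: symD)

lemma subset_common_nbhd_twice:
  "A \<subseteq> pverts G \<Longrightarrow> A \<subseteq> common_nbhd G (common_nbhd G A)"
  using parcs_sym by (auto simp: common_nbhd_def)

lemma common_nbhd_thrice:
  assumes "A \<subseteq> pverts G"
  shows "common_nbhd G (common_nbhd G (common_nbhd G A)) = common_nbhd G A"
  using subset_common_nbhd_twice[OF assms] subset_common_nbhd_twice[OF common_nbhd_subset]
    common_nbhd_antimono by (metis subset_antisym)

lemma common_nbhd_disjoint: "A \<inter> common_nbhd G A = {}"
  using pair_no_loops by (fastforce simp: common_nbhd_def)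

text \<open>Absence of loops makes \<open>U\<close> and \<open>W\<close> disjoint, and symmetry of
  the arcs provides both directions of each edge.\<close>

lemma complete_bipartite_subgraph:
  assumes "U \<subseteq> pverts G" "W \<subseteq> common_nbhd G U"
  shows "\<exists>H. Digraph_Component.subgraph H (with_proj G) \<and>
    complete_bipartite_digraph (card U) (card W) H"
proof -
  define H where "H = \<lparr>pverts = U \<union> W, parcs = U \<times> W \<union> W \<times> U\<rparr>"
  have W: "W \<subseteq> pverts G" using assms(2) common_nbhd_subset by fast
  have disj: "U \<inter> W = {}" using assms(2) common_nbhd_disjoint by blast
  have "finite (U \<union> W)" using assms(1) W pair_finite_verts by (auto intro: finite_subset)
  then have "complete_bipartite_digraph (card U) (card W) (with_proj H)"
    unfolding complete_bipartite_digraph_pair_def using disj by (auto simp: H_def)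
  moreover have "parcs H \<subseteq> parcs G"
    using assms(2) parcs_sym by (auto simp: H_def common_nbhd_def)
  moreover have "wf_digraph (with_proj H)"
    unfolding wf_digraph_wp_iff by unfold_locales (auto simp: H_def)
  ultimately show ?thesis
    using assms(1) W wf_digraph
    by (intro exI[of _ "with_proj H"])
      (auto simp: Digraph_Component.subgraph_def Digraph_Component.compatible_def H_def)
qed

lemma card_less_if_no_complete_bipartite:
  assumes "\<not> (\<exists>H. Digraph_Component.subgraph H (with_proj G) \<and> complete_bipartite_digraph l m H)"
    and "U \<subseteq> pverts G"
  shows "card U < l \<or> card (common_nbhd G U) < m"
proof (rule ccontr)
  assume "\<not> ?thesis"
  then have "l \<le> card U" "m \<le> card (common_nbhd G U)" by auto
  \<comment> \<open>Shrinking \<open>U\<close> only enlarges its common neighborhood, so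
    \<open>W\<close> remains inside.\<close>
  then obtain U' W where U': "U' \<subseteq> U" "card U' = l" and W: "W \<subseteq> common_nbhd G U" "card W = m"
    by (metis obtain_subset_with_card_n)
  then have "W \<subseteq> common_nbhd G U'" using common_nbhd_antimono by fast
  moreover have "U' \<subseteq> pverts G" using U' assms(2) by blast
  ultimately show False using complete_bipartite_subgraph[of U' W] U' W assms(1) by auto
qed

text \<open>Along a chain of closed sets both the size of \<open>C\<close> and the size of CN(C)
  determine \<open>C\<close>. Hence at most l - 1 members have size in 1..l-1, at most m - 1 have
  CN(C) of size in 1..m-1, and every member is of one of these kinds.\<close>

lemma card_chain_of_closed_sets_le:
  assumes no: "\<not> (\<exists>H. Digraph_Component.subgraph H (with_proj G) \<and> complete_bipartite_digraph l m H)"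
    and "l \<ge> 1" "m \<ge> 1"
    and closed: "\<And>C. C \<in> \<C> \<Longrightarrow> C \<subseteq> pverts G \<and> common_nbhd G (common_nbhd G C) = C"
    and ne: "\<And>C. C \<in> \<C> \<Longrightarrow> C \<noteq> {} \<and> common_nbhd G C \<noteq> {}"
    and chain: "\<And>C D. C \<in> \<C> \<Longrightarrow> D \<in> \<C> \<Longrightarrow> C \<subseteq> D \<or> D \<subseteq> C"
  shows "card \<C> \<le> l + m - 2"
proof -
  have fin: "finite C" if "C \<subseteq> pverts G" for C using that pair_finite_verts finite_subset by blast
  have inj: "inj_on card \<C>"
    by (rule inj_onI) (metis card_subset_eq chain closed fin)
  have inj': "inj_on (\<lambda>C. card (common_nbhd G C)) \<C>"
  proof (rule inj_onI)
    fix C D assume CD: "C \<in> \<C>" "D \<in> \<C>" "card (common_nbhd G C) = card (common_nbhd G D)"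
    then have "common_nbhd G C = common_nbhd G D"
      using chain[OF CD(1,2)] common_nbhd_antimono fin[OF common_nbhd_subset]
      by (metis card_subset_eq)
    then show "C = D" using closed CD by metis
  qed
  define \<A> where "\<A> = {C \<in> \<C>. card C < l}"
  define \<B> where "\<B> = {C \<in> \<C>. card (common_nbhd G C) < m}"
  have "card C > 0" "card (common_nbhd G C) > 0" if "C \<in> \<C>" for C
    using ne[OF that] closed[OF that] fin fin[OF common_nbhd_subset] by (auto simp: card_gt_0_iff)
  then have "card ` \<A> \<subseteq> {1..<l}" "(\<lambda>C. card (common_nbhd G C)) ` \<B> \<subseteq> {1..<m}"
    by (auto simp: \<A>_def \<B>_def Suc_le_eq)
  then have "card \<A> \<le> card {1..<l}" "card \<B> \<le> card {1..<m}"
    using inj_on_subset[OF inj, of \<A>] inj_on_subset[OF inj', of \<B>]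
    by (auto simp: \<A>_def \<B>_def intro!: card_inj_on_le simp del: card_atLeastLessThan)
  moreover have "\<C> = \<A> \<union> \<B>"
    using card_less_if_no_complete_bipartite[OF no] closed by (auto simp: \<A>_def \<B>_def)
  then have "card \<C> \<le> card \<A> + card \<B>" using card_Un_le by blast
  ultimately show ?thesis using assms(2,3) by simp
qed

section \<open>The equivariant map from the box complex\<close>

lemma Z2_map_box_complex:
  assumes no: "\<not> (\<exists>H. Digraph_Component.subgraph H (with_proj G) \<and> complete_bipartite_digraph l m H)"
    and lm: "l \<ge> 1" "m \<ge> 1"
  shows "\<exists>f. Z2_map (geometric_realization (box_complex G)) (realization_involution swap_copies)
    (Z2_sphere (int (l + m - 2) - 1)) antipode f"
proof -
  let ?V = "pverts G" and ?N = "common_nbhd G"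
  let ?X = "geometric_realization (box_complex G)"
  note V = pair_finite_verts
  define P where "P = {C. C \<subseteq> ?V \<and> ?N (?N C) = C}"
  \<comment> \<open>The empty set is excluded because its weight is an empty product, which is
    always 1.\<close>
  define Q where "Q = {A. A \<subseteq> ?V \<and> A \<noteq> {}}"
  have fin: "finite P" "finite Q" using V by (auto simp: P_def Q_def)
  define w where "w = level_weight ?V"
  \<comment> \<open>The two copies are subdivided separately. The weight of each set is added to the
    closed set to which it is sent.\<close>
  define y where "y x C = (\<Sum>A\<in>{A \<in> Q. ?N (?N A) = C}. w A (x \<circ> Inl))
    + (\<Sum>B\<in>{B \<in> Q. ?N B = C}. w B (x \<circ> Inr))" for x :: "'a + 'a \<Rightarrow> real" and C
  have w0: "0 \<le> w A z" for A z by (simp add: w_def level_weight_nonneg)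
  have y0: "0 \<le> y x C" for x C
    unfolding y_def by (intro add_nonneg_nonneg sum_nonneg w0)
  have y_pos: "0 < y x C \<longleftrightarrow> (\<exists>A\<in>Q. ?N (?N A) = C \<and> 0 < w A (x \<circ> Inl))
      \<or> (\<exists>B\<in>Q. ?N B = C \<and> 0 < w B (x \<circ> Inr))" (is "_ \<longleftrightarrow> ?R") for x C
  proof -
    have "y x C = 0 \<longleftrightarrow> \<not> ?R"
      unfolding y_def using fin(2)
      by (auto simp: add_nonneg_eq_0_iff sum_nonneg sum_nonneg_eq_0_iff w0 order_less_le)
    then show ?thesis using y0[of x C] by linarith
  qed
  have simplex: "\<exists>A B. {v. x v \<noteq> 0} = A <+> B \<and> A \<subseteq> ?N B \<and> B \<subseteq> ?N A \<and> ?N A \<noteq> {} \<and> ?N B \<noteq> {}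
      \<and> A \<subseteq> ?V \<and> B \<subseteq> ?V \<and> A <+> B \<noteq> {}" "\<And>v. 0 \<le> x v"
    if "x \<in> topspace ?X" for x
  proof -
    have x: "\<And>v. 0 \<le> x v" "{v. x v \<noteq> 0} \<in> box_complex G" "(\<Sum>v | x v \<noteq> 0. x v) = 1"
      using that by (auto simp: geometric_realization_def)
    then have "{v. x v \<noteq> 0} \<noteq> {}" by force
    then show "\<exists>A B. {v. x v \<noteq> 0} = A <+> B \<and> A \<subseteq> ?N B \<and> B \<subseteq> ?N A \<and> ?N A \<noteq> {} \<and> ?N B \<noteq> {}
      \<and> A \<subseteq> ?V \<and> B \<subseteq> ?V \<and> A <+> B \<noteq> {}"
      using x(2) unfolding box_complex_def nbhd_complex_def by blast
    show "0 \<le> x v" for v by (rule x(1))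
  qed
  have supp: "{C \<in> P. 0 < y x C} \<noteq> {}"
    "\<And>C. 0 < y x C \<Longrightarrow> C \<in> P \<and> C \<noteq> {} \<and> ?N C \<noteq> {}"
    "\<And>C D. 0 < y x C \<Longrightarrow> 0 < y x D \<Longrightarrow> C \<subseteq> D \<or> D \<subseteq> C"
    if x: "x \<in> topspace ?X" for x
  proof -
    obtain A0 B0 where AB: "{v. x v \<noteq> 0} = A0 <+> B0" "A0 \<subseteq> ?N B0" "?N A0 \<noteq> {}" "?N B0 \<noteq> {}"
      "A0 \<subseteq> ?V" "B0 \<subseteq> ?V" "A0 <+> B0 \<noteq> {}"
      using simplex(1)[OF x] by blast
    have x0: "0 \<le> x v" for v using simplex(2)[OF x] .
    have mem: "x v \<noteq> 0 \<longleftrightarrow> v \<in> A0 <+> B0" for v using AB(1) by blast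
    \<comment> \<open>Coordinates are nonnegative, so the support is where they are
      positive.\<close>
    have A0: "A0 = {a \<in> ?V. 0 < (x \<circ> Inl) a}" and B0: "B0 = {b \<in> ?V. 0 < (x \<circ> Inr) b}"
      using mem[of "Inl _"] mem[of "Inr _"] AB(5,6) x0 by (auto simp: order_less_le)
    have wsub: "A \<subseteq> {a \<in> ?V. 0 < z a}" if "A \<in> Q" "0 < w A z" for A z
      using that level_weight_pos_iff[OF V, of A z] by (auto simp: Q_def w_def)
    have left: "A \<subseteq> A0" if "A \<in> Q" "0 < w A (x \<circ> Inl)" for A
      using wsub[OF that] that A0 by simp
    have right: "B \<subseteq> B0" if "B \<in> Q" "0 < w B (x \<circ> Inr)" for B
      using wsub[OF that] that B0 by simp
    have wpos: "0 < w {a \<in> ?V. 0 < z a} z" for z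
      unfolding w_def using V by (rule level_weight_support_pos)
    have closedN: "?N A \<in> P" if "A \<subseteq> ?V" for A
      using common_nbhd_thrice[OF that] common_nbhd_subset[of G A] by (simp add: P_def)
    show PC: "C \<in> P \<and> C \<noteq> {} \<and> ?N C \<noteq> {}" if "0 < y x C" for C
    proof -
      \<comment> \<open>Here \<open>A'\<close> will be \<open>A0\<close> or \<open>B0\<close>: CN(A)
        contains the nonempty CN(A'), and CN(CN(A)) contains the nonempty \<open>A\<close>.\<close>
      have *: "?N A \<in> P" "?N A \<noteq> {}" "?N (?N A) \<in> P" "?N (?N A) \<noteq> {}"
          "?N (?N (?N A)) \<noteq> {}"
        if "A \<in> Q" "A \<subseteq> A'" "?N A' \<noteq> {}" for A A'
      proof -
        have A: "A \<subseteq> ?V" "A \<noteq> {}" using that by (auto simp: Q_def)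
        show "?N A \<noteq> {}" using that common_nbhd_antimono by (metis subset_empty)
        then show "?N (?N (?N A)) \<noteq> {}" using common_nbhd_thrice[OF A(1)] by simp
        show "?N (?N A) \<noteq> {}" using subset_common_nbhd_twice[OF A(1)] A(2) by blast
        show "?N A \<in> P" "?N (?N A) \<in> P" using closedN[OF A(1)] closedN[OF common_nbhd_subset] by auto
      qed
      from that consider A where "A \<in> Q" "0 < w A (x \<circ> Inl)" "C = ?N (?N A)"
        | B where "B \<in> Q" "0 < w B (x \<circ> Inr)" "C = ?N B"
        unfolding y_pos by blast
      then show ?thesis
      proof cases
        case 1
        then show ?thesis using *[OF 1(1) _ AB(3)] left by simp
      next
        case 2
        then show ?thesis using *[OF 2(1) _ AB(4)] right by simp
      qed
    qed
    show "{C \<in> P. 0 < y x C} \<noteq> {}"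
    proof -
      have "\<exists>C. 0 < y x C"
      proof (cases "A0 = {}")
        case False
        then have "A0 \<in> Q" "0 < w A0 (x \<circ> Inl)"
          using AB(5) wpos[of "x \<circ> Inl"] A0 by (auto simp: Q_def)
        then show ?thesis unfolding y_pos by blast
      next
        case True
        then have "B0 \<in> Q" "0 < w B0 (x \<circ> Inr)"
          using AB(6,7) wpos[of "x \<circ> Inr"] B0 by (auto simp: Q_def)
        then show ?thesis unfolding y_pos by blast
      qed
      then show ?thesis using PC by blast
    qed
    have nested: "A \<subseteq> B \<or> B \<subseteq> A" if "A \<in> Q" "B \<in> Q" "0 < w A z" "0 < w B z" for A B z
      using level_weight_pos_nested[OF V] that by (simp add: Q_def w_def)
    \<comment> \<open>Level sets from different copies are comparable since A \<subseteq> A0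
      \<subseteq> CN(B0) \<subseteq> CN(B), and applying CN twice preserves inclusions and fixes
      CN(B).\<close>
    have mixed: "?N (?N A) \<subseteq> ?N B" if "A \<in> Q" "0 < w A (x \<circ> Inl)" "B \<in> Q" "0 < w B (x \<circ> Inr)" for A B
    proof -
      have "A \<subseteq> ?N B"
        using left[OF that(1,2)] right[OF that(3,4)] AB(2) common_nbhd_antimono by blast
      then have "?N (?N A) \<subseteq> ?N (?N (?N B))" by (intro common_nbhd_antimono)
      then show ?thesis using that(3) common_nbhd_thrice by (simp add: Q_def)
    qed
    show "C \<subseteq> D \<or> D \<subseteq> C" if "0 < y x C" "0 < y x D" for C D
      using that unfolding y_pos
      by (elim disjE bexE conjE) (metis nested mixed common_nbhd_antimono)+
  qed
  have contx: "continuous_map ?X euclideanreal (\<lambda>x. x v)" for v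
    unfolding geometric_realization_def
    by (auto intro!: continuous_map_from_subtopology continuous_map_product_projection)
  show ?thesis
  proof (rule Z2_map_sphere_of_coordinates[where V = P and s = ?N and y = y])
    show "finite P" by (rule fin)
    show "?N C \<in> P \<and> ?N (?N C) = C" if "C \<in> P" for C
      using that common_nbhd_subset[of G C] by (simp add: P_def)
    show "continuous_map ?X euclideanreal (\<lambda>x. y x C)" for C
      unfolding y_def w_def using fin V contx
      by (intro continuous_map_add continuous_map_sum continuous_map_level_weight)
        (auto simp: Q_def)
    show "\<exists>C\<in>P. 0 < y x C" if "x \<in> topspace ?X" for x
      using supp(1)[OF that] by blast
    \<comment> \<open>Swapping the copies exchanges the two sums: CN is an involution on closed
      sets, so it matches their index sets.\<close>
    show "y (realization_involution swap_copies x) (?N C) = y x C" if "C \<in> P" for x C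
    proof -
      have "realization_involution swap_copies x \<circ> Inl = x \<circ> Inr"
        "realization_involution swap_copies x \<circ> Inr = x \<circ> Inl"
        by (auto simp: realization_involution_def)
      moreover have "?N (?N A) = ?N C \<longleftrightarrow> ?N A = C" "?N A = ?N C \<longleftrightarrow> ?N (?N A) = C"
        if "A \<in> Q" for A
      proof -
        have "?N (?N (?N A)) = ?N A" "?N (?N C) = C"
          using that \<open>C \<in> P\<close> common_nbhd_thrice[of A] by (simp_all add: P_def Q_def)
        then show "?N (?N A) = ?N C \<longleftrightarrow> ?N A = C" "?N A = ?N C \<longleftrightarrow> ?N (?N A) = C"
          by metis+
      qed
      then have "{A \<in> Q. ?N (?N A) = ?N C} = {A \<in> Q. ?N A = C}"
        "{A \<in> Q. ?N A = ?N C} = {A \<in> Q. ?N (?N A) = C}"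
        by blast+
      ultimately show ?thesis unfolding y_def by simp
    qed
    show "card {C \<in> P. 0 < y x C} \<le> l + m - 2" if "x \<in> topspace ?X" for x
      using supp(2,3)[OF that] by (intro card_chain_of_closed_sets_le[OF no lm]) (auto simp: P_def)
    \<comment> \<open>If both weights were positive, \<open>C\<close> and CN(C) would be comparable,
      disjoint and nonempty.\<close>
    show "\<not> 0 < y x (?N C)" if "x \<in> topspace ?X" "0 < y x C" for x C
      using supp(2,3)[OF that(1)] that(2) common_nbhd_disjoint[of C] by blast
  qed
qed

end

theorem theorem1:
  fixes G :: "'a pair_pre_digraph" and l m :: nat
  assumes "pair_graph G"
    and "Digraph_Component.connected (with_proj G)"
    and "l \<ge> 1" and "m \<ge> 1"
    and "\<not> (\<exists>H. Digraph_Component.subgraph H (with_proj G) \<and> complete_bipartite_digraph l m H)"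
  shows "complex_index (box_complex G) swap_copies \<le> ereal (real l + real m - 3)"
proof -
  interpret pair_graph G by fact
  let ?d = "int (l + m - 2) - 1"
  have d: "real_of_int ?d = real l + real m - 3" using assms(3,4) by simp
  show ?thesis
    unfolding complex_index_def Z2_index_def d[symmetric]
    using Z2_map_box_complex[OF assms(5,3,4)] by (intro Inf_lower CollectI exI[of _ ?d]) simp
qed

end
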